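(* For any positive integer $r$, if $G$ is a graph with $m$ edges and maximum degree at most $r$, then $G$ has a bipartition $V_1 \cup V_2$ of its vertex set in which the part sizes differ by at most $\frac{r}{2} + 1$ and whose size $e(V_1,V_2)$ is at least $\frac{r+1}{2r} m$ when $r$ is odd, and at least $\frac{r+2}{2(r+1)} m$ when $r$ is even.
   Context: Graphs are finite and simple. A bipartition of the vertex set is a partition into two disjoint parts $V_1, V_2$; its size $e(V_1,V_2)$ is the number of edges with one endpoint in each part. *)

theory Defs
  imports Complex_Main
begin

(* Edges are two-element sets of vertices, so loops and parallel edges are excluded.
   The graph without vertices is not excluded. *)
definition simple_graph :: "'a set \<Rightarrow> 'a set set \<Rightarrow> bool" where
  "simple_graph V E \<longleftrightarrow> finite V \<and> (\<forall>e\<in>E. e \<subseteq> V \<and> card e = 2)"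

definition degree :: "'a set set \<Rightarrow> 'a \<Rightarrow> nat" where
  "degree E v = card {e \<in> E. v \<in> e}"

(* Inserting 0 only matters for V = {}, where Max would otherwise be unspecified. *)
definition max_degree :: "'a set \<Rightarrow> 'a set set \<Rightarrow> nat" where
  "max_degree V E = Max (insert 0 (degree E ` V))"

(* A part may be empty: a graph with a single vertex has no other bipartition. *)
definition bipartition :: "'a set \<Rightarrow> 'a set \<Rightarrow> 'a set \<Rightarrow> bool" where
  "bipartition V V1 V2 \<longleftrightarrow> V1 \<union> V2 = V \<and> V1 \<inter> V2 = {}"

definition cut_size :: "'a set set \<Rightarrow> 'a set \<Rightarrow> 'a set \<Rightarrow> nat" where
  "cut_size E V1 V2 = card {e \<in> E. \<exists>x\<in>V1. \<exists>y\<in>V2. e = {x, y}}"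

end

theory Submission
  imports Defs
begin

text \<open>The case of even \<open>r\<close> follows from that of \<open>r + 1\<close>, so let \<open>r\<close> be odd. Orient the edges of a
  maximum matching independently at random. Every matching edge is cut, every other edge between
  matched vertices is cut with probability 1/2, and the exposed vertices are independent. For an
  exposed vertex \<open>v\<close> let \<open>X v\<close> be the sum of the random signs of its neighbours. If
  \<open>X v \<noteq> X w\<close> as random variables, then \<open>\<bar>X v - X w\<bar>\<close> has mean at least 1, since
  flipping one matching edge changes \<open>X v - X w\<close> by at least 2; placing \<open>v\<close> and \<open>w\<close> on opposite
  sides in the better way therefore gains enough and costs no balance. After removing such pairs,
  all remaining \<open>X v\<close> coincide. If they are not 0, these vertices number at most \<open>r - 1\<close>
  and a three-to-one split in favour of the better side suffices. If they are 0, then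
  the neighbourhood of each remaining \<open>v\<close> is a union of matching edges. Choosing the matching with as
  few such vertices as possible makes all degrees in these neighbourhoods even, hence smaller than
  \<open>r\<close>, and this slack pays for \<open>v\<close>.\<close>

section \<open>Balanced signings adapted to a family of random variables\<close>

text \<open>\<open>\<Omega>\<close> serves as a uniform sample space, and \<open>\<tau>\<close> may
  react to the outcome. The target is a mean gain of 1/2 for every \<open>v\<close> with nonzero
  \<open>X\<close>. A pair with different \<open>X\<close> gets opposite signs: its balance is 0 and
  its mean gain of at least 1 pays for both members. Induction handles the rest, until all
  \<open>X\<close> agree.\<close>

lemma exists_balanced_signing:
  fixes X :: "'w \<Rightarrow> 'a \<Rightarrow> int" and r :: nat
  assumes "finite I" "odd r"
    and "\<And>v w. v \<in> I \<Longrightarrow> w \<in> I \<Longrightarrow> \<exists>\<omega>\<in>\<Omega>. X \<omega> v \<noteq> X \<omega> w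
           \<Longrightarrow> int (card \<Omega>) \<le> (\<Sum>\<omega>\<in>\<Omega>. \<bar>X \<omega> v - X \<omega> w\<bar>)"
    and "\<And>v. v \<in> I \<Longrightarrow> \<exists>\<omega>\<in>\<Omega>. X \<omega> v \<noteq> 0 \<Longrightarrow> int (card \<Omega>) \<le> (\<Sum>\<omega>\<in>\<Omega>. \<bar>X \<omega> v\<bar>)"
    and "\<And>v. v \<in> I \<Longrightarrow> \<exists>\<omega>\<in>\<Omega>. X \<omega> v \<noteq> 0
           \<Longrightarrow> card {w \<in> I. \<forall>\<omega>\<in>\<Omega>. X \<omega> w = X \<omega> v} < r"
  shows "\<exists>\<tau>. (\<forall>\<omega> v. \<tau> \<omega> v \<in> {1, -1}) \<and> (\<forall>\<omega>. 2 * \<bar>\<Sum>v\<in>I. \<tau> \<omega> v\<bar> \<le> int r + 1)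
    \<and> 2 * (\<Sum>\<omega>\<in>\<Omega>. \<Sum>v\<in>I. \<tau> \<omega> v * X \<omega> v)
        \<le> - int (card \<Omega>) * int (card {v \<in> I. \<exists>\<omega>\<in>\<Omega>. X \<omega> v \<noteq> 0})"
  using assms(1,3-)
proof (induction I rule: finite_psubset_induct)
  case (psubset I)
  have r: "r \<ge> 1" using assms(2) by (cases r) auto
  show ?case
  proof (cases "\<exists>v\<in>I. \<exists>w\<in>I. \<exists>\<omega>\<in>\<Omega>. X \<omega> v \<noteq> X \<omega> w")
    case True
    then obtain v w where vw: "v \<in> I" "w \<in> I" "\<exists>\<omega>\<in>\<Omega>. X \<omega> v \<noteq> X \<omega> w" by blast
    then have ne: "v \<noteq> w" by auto
    define J where "J = I - {v, w}"
    have J: "J \<subset> I" "finite J" "v \<notin> J" "w \<notin> J" and I: "I = insert v (insert w J)"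
      using vw psubset.hyps by (auto simp: J_def)
    have less: "card {u \<in> J. \<forall>\<omega>\<in>\<Omega>. X \<omega> u = X \<omega> x} < r" if "x \<in> J" "\<exists>\<omega>\<in>\<Omega>. X \<omega> x \<noteq> 0" for x
    proof -
      have "card {u \<in> J. \<forall>\<omega>\<in>\<Omega>. X \<omega> u = X \<omega> x} \<le> card {u \<in> I. \<forall>\<omega>\<in>\<Omega>. X \<omega> u = X \<omega> x}"
        using J psubset.hyps by (intro card_mono) auto
      also have "\<dots> < r" using that J by (intro psubset.prems(3)) auto
      finally show ?thesis .
    qed
    have "\<exists>\<tau>. (\<forall>\<omega> v. \<tau> \<omega> v \<in> {1, -1}) \<and> (\<forall>\<omega>. 2 * \<bar>\<Sum>v\<in>J. \<tau> \<omega> v\<bar> \<le> int r + 1)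
      \<and> 2 * (\<Sum>\<omega>\<in>\<Omega>. \<Sum>v\<in>J. \<tau> \<omega> v * X \<omega> v)
          \<le> - int (card \<Omega>) * int (card {v \<in> J. \<exists>\<omega>\<in>\<Omega>. X \<omega> v \<noteq> 0})"
      using J(1) by (intro psubset.IH[OF J(1)] psubset.prems(1,2) less) auto
    then obtain \<tau> where \<tau>: "\<And>\<omega> v. \<tau> \<omega> v \<in> {1, -1}"
        "\<And>\<omega>. 2 * \<bar>\<Sum>v\<in>J. \<tau> \<omega> v\<bar> \<le> int r + 1"
        "2 * (\<Sum>\<omega>\<in>\<Omega>. \<Sum>v\<in>J. \<tau> \<omega> v * X \<omega> v)
          \<le> - int (card \<Omega>) * int (card {v \<in> J. \<exists>\<omega>\<in>\<Omega>. X \<omega> v \<noteq> 0})"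
      by blast
    define s :: "'w \<Rightarrow> int" where "s \<omega> = (if X \<omega> v \<le> X \<omega> w then 1 else -1)" for \<omega>
    define \<tau>' where "\<tau>' \<omega> u = (if u = v then s \<omega> else if u = w then - s \<omega> else \<tau> \<omega> u)" for \<omega> u
    have split: "(\<Sum>u\<in>I. \<tau>' \<omega> u * g u) = s \<omega> * (g v - g w) + (\<Sum>u\<in>J. \<tau> \<omega> u * g u)" for \<omega> g
    proof -
      have "(\<Sum>u\<in>J. \<tau>' \<omega> u * g u) = (\<Sum>u\<in>J. \<tau> \<omega> u * g u)"
        using J by (intro sum.cong) (auto simp: \<tau>'_def)
      then show ?thesis
        unfolding I using J ne by (simp add: \<tau>'_def algebra_simps)
    qed
    have "\<tau>' \<omega> u \<in> {1, -1}" for \<omega> u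
      using \<tau>(1)[of \<omega> u] by (auto simp: \<tau>'_def s_def)
    moreover have "2 * \<bar>\<Sum>u\<in>I. \<tau>' \<omega> u\<bar> \<le> int r + 1" for \<omega>
      using split[of \<omega> "\<lambda>_. 1"] \<tau>(2)[of \<omega>] by simp
    moreover have "2 * (\<Sum>\<omega>\<in>\<Omega>. \<Sum>u\<in>I. \<tau>' \<omega> u * X \<omega> u)
        \<le> - int (card \<Omega>) * int (card {v \<in> I. \<exists>\<omega>\<in>\<Omega>. X \<omega> v \<noteq> 0})"
    proof -
      have "s \<omega> * (X \<omega> v - X \<omega> w) = - \<bar>X \<omega> v - X \<omega> w\<bar>" for \<omega>
        by (auto simp: s_def)
      then have "(\<Sum>\<omega>\<in>\<Omega>. \<Sum>u\<in>I. \<tau>' \<omega> u * X \<omega> u)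
          = - (\<Sum>\<omega>\<in>\<Omega>. \<bar>X \<omega> v - X \<omega> w\<bar>) + (\<Sum>\<omega>\<in>\<Omega>. \<Sum>u\<in>J. \<tau> \<omega> u * X \<omega> u)"
        by (simp add: split sum_subtractf)
      moreover have "int (card \<Omega>) \<le> (\<Sum>\<omega>\<in>\<Omega>. \<bar>X \<omega> v - X \<omega> w\<bar>)"
        using psubset.prems(1)[OF vw] .
      moreover have "card {v \<in> I. \<exists>\<omega>\<in>\<Omega>. X \<omega> v \<noteq> 0} \<le> card {v \<in> J. \<exists>\<omega>\<in>\<Omega>. X \<omega> v \<noteq> 0} + 2"
      proof -
        have "card {v \<in> I. \<exists>\<omega>\<in>\<Omega>. X \<omega> v \<noteq> 0}
            \<le> card ({v \<in> J. \<exists>\<omega>\<in>\<Omega>. X \<omega> v \<noteq> 0} \<union> {v, w})"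
          using J(2) by (intro card_mono) (auto simp: I)
        also have "\<dots> \<le> card {v \<in> J. \<exists>\<omega>\<in>\<Omega>. X \<omega> v \<noteq> 0} + card {v, w}" by (rule card_Un_le)
        finally show ?thesis using ne by simp
      qed
      then have "int (card \<Omega>) * int (card {v \<in> I. \<exists>\<omega>\<in>\<Omega>. X \<omega> v \<noteq> 0})
          \<le> int (card \<Omega>) * (int (card {v \<in> J. \<exists>\<omega>\<in>\<Omega>. X \<omega> v \<noteq> 0}) + 2)"
        by (intro mult_left_mono) auto
      ultimately show ?thesis using \<tau>(3) by (simp add: algebra_simps)
    qed
    ultimately show ?thesis by (intro exI[of _ \<tau>']) blast
  next
    case False
    have const: "X \<omega> v = X \<omega> w" if "\<omega> \<in> \<Omega>" "v \<in> I" "w \<in> I" for \<omega> v w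
      using False that by blast
    have signed: "(\<Sum>u\<in>I. if u \<in> I1 then 1 else -1 :: int) = 2 * int (card I1) - int (card I)"
      if "I1 \<subseteq> I" for I1
    proof -
      have "(\<Sum>u\<in>I. if u \<in> I1 then 1 else -1 :: int) = (\<Sum>u\<in>I. 2 * (if u \<in> I1 then 1 else 0) - 1)"
        by (intro sum.cong) auto
      also have "\<dots> = 2 * (\<Sum>u\<in>I. if u \<in> I1 then 1 else 0) - int (card I)"
        by (simp add: sum_subtractf sum_distrib_left)
      also have "(\<Sum>u\<in>I. if u \<in> I1 then 1 else 0 :: int) = int (card I1)"
        using that psubset.hyps by (simp add: sum.If_cases Int_absorb1)
      finally show ?thesis .
    qed
    show ?thesis
    proof (cases "\<exists>v\<in>I. \<exists>\<omega>\<in>\<Omega>. X \<omega> v \<noteq> 0")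
      case False
      \<comment> \<open>With all \<open>X\<close> zero only balance matters. Halving leaves a
        difference of at most 1, which is at most \<open>(r + 1) / 2\<close> since
        \<open>r \<ge> 1\<close>.\<close>
      obtain I1 where I1: "I1 \<subseteq> I" "card I1 = card I div 2"
        using obtain_subset_with_card_n[of "card I div 2" I] by (metis div_le_dividend)
      have "2 * \<bar>2 * int (card I1) - int (card I)\<bar> \<le> int r + 1"
        using r unfolding I1(2) by presburger
      moreover have "(\<Sum>\<omega>\<in>\<Omega>. \<Sum>v\<in>I. (if v \<in> I1 then 1 else -1) * X \<omega> v) = 0"
        using False by (intro sum.neutral ballI) auto
      moreover have "{v \<in> I. \<exists>\<omega>\<in>\<Omega>. X \<omega> v \<noteq> 0} = {}" using False by blast
      ultimately show ?thesis
        using signed[OF I1(1)]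
        by (intro exI[of _ "\<lambda>\<omega> v. if v \<in> I1 then 1 else -1"]) (simp only: card.empty, simp)
    next
      case True
      then obtain v where v: "v \<in> I" "\<exists>\<omega>\<in>\<Omega>. X \<omega> v \<noteq> 0" by blast
      have "{w \<in> I. \<forall>\<omega>\<in>\<Omega>. X \<omega> w = X \<omega> v} = I" using const v(1) by blast
      then have c: "card I < r" using psubset.prems(3)[OF v] by simp
      \<comment> \<open>The surplus of the larger side lies between \<open>card I / 2\<close> and \<open>(card I + 3) / 2\<close>.\<close>
      define a where "a = (3 * card I + 3) div 4"
      have a: "3 * card I \<le> 4 * a" "4 * a \<le> 3 * card I + 3" "a \<le> card I"
        unfolding a_def by presburger+
      obtain I1 where I1: "I1 \<subseteq> I" "card I1 = a"
        using obtain_subset_with_card_n[OF a(3)] by metis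
      \<comment> \<open>The larger part \<open>I1\<close> takes the sign opposite to the common
        value \<open>X \<omega> v\<close>.\<close>
      define s :: "'w \<Rightarrow> int" where "s \<omega> = (if X \<omega> v \<le> 0 then 1 else -1)" for \<omega>
      define \<tau> where "\<tau> \<omega> u = s \<omega> * (if u \<in> I1 then 1 else -1)" for \<omega> u
      have sum\<tau>: "(\<Sum>u\<in>I. \<tau> \<omega> u) = s \<omega> * (2 * int a - int (card I))" for \<omega>
        unfolding \<tau>_def using signed[OF I1(1)] I1(2) by (simp add: sum_distrib_left[symmetric])
      have "\<tau> \<omega> u \<in> {1, -1}" for \<omega> u by (auto simp: \<tau>_def s_def)
      moreover have "2 * \<bar>\<Sum>u\<in>I. \<tau> \<omega> u\<bar> \<le> int r + 1" for \<omega>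
      proof -
        \<comment> \<open>Since \<open>card I \<le> 2 * k\<close>, the surplus is at most
          \<open>k + 3/2\<close>, hence by integrality at most
          \<open>k + 1 = (r + 1) / 2\<close>.\<close>
        obtain k where "r = 2 * k + 1" using assms(2) by (auto elim: oddE)
        moreover have "2 * int a \<le> int (card I) + int k + 1" "int (card I) \<le> 2 * int a"
          using c a calculation by linarith+
        ultimately have "2 * \<bar>2 * int a - int (card I)\<bar> \<le> int r + 1" by (simp add: abs_if)
        moreover have "\<bar>\<Sum>u\<in>I. \<tau> \<omega> u\<bar> = \<bar>2 * int a - int (card I)\<bar>"
          unfolding sum\<tau> by (simp add: s_def abs_mult)
        ultimately show ?thesis by simp
      qed
      moreover have "2 * (\<Sum>\<omega>\<in>\<Omega>. \<Sum>u\<in>I. \<tau> \<omega> u * X \<omega> u)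
        \<le> - int (card \<Omega>) * int (card {v \<in> I. \<exists>\<omega>\<in>\<Omega>. X \<omega> v \<noteq> 0})"
      proof -
        let ?d = "2 * int a - int (card I)"
        have "(\<Sum>u\<in>I. \<tau> \<omega> u * X \<omega> u) = - ?d * \<bar>X \<omega> v\<bar>" if "\<omega> \<in> \<Omega>" for \<omega>
        proof -
          have "(\<Sum>u\<in>I. \<tau> \<omega> u * X \<omega> u) = (\<Sum>u\<in>I. \<tau> \<omega> u) * X \<omega> v"
            unfolding sum_distrib_right using const[OF that _ v(1)] by (intro sum.cong) auto
          then show ?thesis unfolding sum\<tau> s_def
            by (cases "X \<omega> v \<le> 0") (simp_all add: left_diff_distrib)
        qed
        then have "(\<Sum>\<omega>\<in>\<Omega>. \<Sum>u\<in>I. \<tau> \<omega> u * X \<omega> u) = - ?d * (\<Sum>\<omega>\<in>\<Omega>. \<bar>X \<omega> v\<bar>)"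
          by (simp add: sum_distrib_left)
        moreover have "2 * ?d \<ge> int (card I)"
          using of_nat_mono[OF a(1), where 'a = int] by simp
        then have "2 * ?d * (\<Sum>\<omega>\<in>\<Omega>. \<bar>X \<omega> v\<bar>) \<ge> int (card I) * int (card \<Omega>)"
          using psubset.prems(2)[OF v] by (intro mult_mono) auto
        moreover have "{v \<in> I. \<exists>\<omega>\<in>\<Omega>. X \<omega> v \<noteq> 0} = I"
        proof -
          obtain \<omega> where \<omega>: "\<omega> \<in> \<Omega>" "X \<omega> v \<noteq> 0" using v(2) by blast
          have "X \<omega> u \<noteq> 0" if "u \<in> I" for u using const[OF \<omega>(1) that v(1)] \<omega>(2) by simp
          then show ?thesis using \<omega>(1) by blast
        qed
        ultimately show ?thesis by (simp add: algebra_simps)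
      qed
      ultimately show ?thesis by (intro exI[of _ \<tau>]) blast
    qed
  qed
qed

section \<open>Random orientations of the pairs of an involution\<close>

definition support :: "('a \<Rightarrow> 'a) \<Rightarrow> 'a set" where
  "support f = {v. f v \<noteq> v}"

text \<open>The sample space: each pair \<open>{t, f t}\<close> receives opposite signs. The value 0
  off the support makes this set finite even over an infinite type.\<close>

definition antisym_signs :: "('a \<Rightarrow> 'a) \<Rightarrow> ('a \<Rightarrow> int) set" where
  "antisym_signs f = {\<omega>. \<forall>t. (t \<in> support f \<longrightarrow> \<omega> t \<in> {1, -1} \<and> \<omega> (f t) = - \<omega> t)
     \<and> (t \<notin> support f \<longrightarrow> \<omega> t = 0)}"

definition flip :: "('a \<Rightarrow> 'a) \<Rightarrow> 'a \<Rightarrow> ('a \<Rightarrow> int) \<Rightarrow> 'a \<Rightarrow> int" where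
  "flip f t \<omega> = (\<lambda>u. if u = t \<or> u = f t then - \<omega> u else \<omega> u)"

locale finite_involution =
  fixes f :: "'a \<Rightarrow> 'a"
  assumes invol [simp]: "f (f v) = v"
    and finite_support: "finite (support f)"
begin

lemma support_closed [simp]: "f t \<in> support f \<longleftrightarrow> t \<in> support f"
  by (metis (mono_tags, lifting) invol mem_Collect_eq support_def)

lemma invol_eq_iff: "f u = v \<longleftrightarrow> u = f v"
  by (metis invol)

lemma finite_antisym_signs: "finite (antisym_signs f)"
  by (rule finite_subset[OF _ finite_set_of_finite_funs[of "support f" "{1, -1 :: int}" 0]])
     (auto simp: antisym_signs_def finite_support)

text \<open>An injection of the support into the naturals decides which end of each pair receives
  1.\<close>

lemma antisym_signs_nonempty: "antisym_signs f \<noteq> {}"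
proof -
  obtain g :: "'a \<Rightarrow> nat" where g: "inj_on g (support f)"
    using finite_imp_inj_to_nat_seg[OF finite_support] by metis
  have "g (f t) \<noteq> g t" if t: "t \<in> support f" for t
  proof
    assume "g (f t) = g t"
    then have "f t = t" by (rule inj_onD[OF g]) (simp_all add: t)
    then show False using t by (simp add: support_def)
  qed
  then have "(\<lambda>t. if t \<in> support f then if g t < g (f t) then 1 else -1 else 0) \<in> antisym_signs f"
    by (auto simp: antisym_signs_def)
  then show ?thesis by blast
qed

lemma flip_flip [simp]: "flip f t (flip f t \<omega>) = \<omega>"
  by (auto simp: flip_def)

lemma flip_antisym_signs: "\<omega> \<in> antisym_signs f \<Longrightarrow> flip f t \<omega> \<in> antisym_signs f"
  by (auto simp: antisym_signs_def flip_def invol_eq_iff)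

lemma sum_flip: "(\<Sum>\<omega>\<in>antisym_signs f. h (flip f t \<omega>)) = (\<Sum>\<omega>\<in>antisym_signs f. h \<omega>)"
  by (rule sum.reindex_bij_witness[of _ "flip f t" "flip f t"]) (auto simp: flip_antisym_signs)

text \<open>For \<open>u\<close> and \<open>w\<close> in different pairs, flipping the pair of
  \<open>u\<close> permutes the sample space and negates the product, so the sum equals its own
  negative.\<close>

lemma sum_sign_product:
  assumes "u \<in> support f" "w \<in> support f"
  shows "(\<Sum>\<omega>\<in>antisym_signs f. \<omega> u * \<omega> w)
    = (if w = u then int (card (antisym_signs f))
       else if w = f u then - int (card (antisym_signs f)) else 0)"
proof -
  have sq: "\<omega> u * \<omega> u = 1" if "\<omega> \<in> antisym_signs f" for \<omega>
    using that assms by (auto simp: antisym_signs_def)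
  have sq': "\<omega> u * \<omega> (f u) = - 1" if "\<omega> \<in> antisym_signs f" for \<omega>
    using that assms by (auto simp: antisym_signs_def)
  show ?thesis
  proof (cases "w = u \<or> w = f u")
    case True
    then show ?thesis using sq sq' assms(1) by (auto simp: support_def)
  next
    case False
    have "(\<Sum>\<omega>\<in>antisym_signs f. \<omega> u * \<omega> w)
        = (\<Sum>\<omega>\<in>antisym_signs f. flip f u \<omega> u * flip f u \<omega> w)"
      by (rule sum_flip[symmetric])
    also have "\<dots> = - (\<Sum>\<omega>\<in>antisym_signs f. \<omega> u * \<omega> w)"
      using False by (simp add: flip_def sum_negf)
    finally show ?thesis using False by simp
  qed
qed

text \<open>Reindexing by \<open>f\<close> isolates the antisymmetric part of the coefficients. The
  factor 2 avoids choosing a representative of each pair.\<close>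

lemma sum_support_antisym:
  fixes c :: "'a \<Rightarrow> int"
  assumes "\<omega> \<in> antisym_signs f"
  shows "2 * (\<Sum>t\<in>support f. c t * \<omega> t) = (\<Sum>t\<in>support f. (c t - c (f t)) * \<omega> t)"
proof -
  have "(\<Sum>t\<in>support f. c t * \<omega> t) = (\<Sum>t\<in>support f. c (f t) * \<omega> (f t))"
    by (rule sum.reindex_bij_witness[of _ f f]) auto
  also have "\<dots> = - (\<Sum>t\<in>support f. c (f t) * \<omega> t)"
    unfolding sum_negf[symmetric] using assms by (intro sum.cong) (auto simp: antisym_signs_def)
  finally show ?thesis by (simp add: algebra_simps sum_subtractf)
qed

lemma linear_form_zero:
  fixes c :: "'a \<Rightarrow> int"
  assumes "\<omega> \<in> antisym_signs f" "\<And>t. t \<in> support f \<Longrightarrow> c t = c (f t)"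
  shows "(\<Sum>t\<in>support f. c t * \<omega> t) = 0"
proof -
  have "(c t - c (f t)) * \<omega> t = 0" if "t \<in> support f" for t
    unfolding assms(2)[OF that, symmetric] by simp
  then have "(\<Sum>t\<in>support f. (c t - c (f t)) * \<omega> t) = 0" by (intro sum.neutral) blast
  then show ?thesis using sum_support_antisym[OF assms(1), of c] by linarith
qed

text \<open>With \<open>linear_form_zero\<close> this gives a dichotomy: a linear form vanishes
  identically or has mean absolute value at least 1. Averaging each outcome with its flip at
  \<open>t\<close> suffices, because the two values differ by
  \<open>2 * \<bar>c t - c (f t)\<bar> \<ge> 2\<close>.\<close>

lemma linear_form_mean_abs:
  fixes c :: "'a \<Rightarrow> int"
  assumes "t \<in> support f" "c t \<noteq> c (f t)"
  shows "int (card (antisym_signs f)) \<le> (\<Sum>\<omega>\<in>antisym_signs f. \<bar>\<Sum>t\<in>support f. c t * \<omega> t\<bar>)"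
proof -
  let ?X = "\<lambda>\<omega>. \<Sum>t\<in>support f. c t * \<omega> t"
  have tf: "t \<noteq> f t" using assms(1) by (auto simp: support_def)
  have "2 \<le> \<bar>?X \<omega>\<bar> + \<bar>?X (flip f t \<omega>)\<bar>" if "\<omega> \<in> antisym_signs f" for \<omega>
  proof -
    have \<omega>: "\<omega> t \<in> {1, -1}" "\<omega> (f t) = - \<omega> t"
      using that assms(1) by (auto simp: antisym_signs_def)
    have "?X \<omega> - ?X (flip f t \<omega>) = (\<Sum>u\<in>support f. if u \<in> {t, f t} then 2 * c u * \<omega> u else 0)"
      unfolding sum_subtractf[symmetric] by (intro sum.cong) (auto simp: flip_def)
    also have "\<dots> = (\<Sum>u\<in>{t, f t}. 2 * c u * \<omega> u)"
      using assms(1) finite_support by (intro sum.mono_neutral_cong_right) auto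
    also have "\<dots> = 2 * (c t - c (f t)) * \<omega> t"
      using tf \<omega> by (simp add: algebra_simps)
    finally have "\<bar>?X \<omega> - ?X (flip f t \<omega>)\<bar> = 2 * \<bar>c t - c (f t)\<bar>"
      using \<omega>(1) by (auto simp: abs_if)
    then have "2 \<le> \<bar>?X \<omega> - ?X (flip f t \<omega>)\<bar>" using assms(2) by simp
    also have "\<dots> \<le> \<bar>?X \<omega>\<bar> + \<bar>?X (flip f t \<omega>)\<bar>" by (rule abs_triangle_ineq4)
    finally show ?thesis .
  qed
  then have "(\<Sum>\<omega>\<in>antisym_signs f. 2) \<le> (\<Sum>\<omega>\<in>antisym_signs f. \<bar>?X \<omega>\<bar> + \<bar>?X (flip f t \<omega>)\<bar>)"
    by (rule sum_mono)
  also have "\<dots> = 2 * (\<Sum>\<omega>\<in>antisym_signs f. \<bar>?X \<omega>\<bar>)"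
    using sum_flip[of "\<lambda>\<omega>. \<bar>?X \<omega>\<bar>" t] by (simp add: sum.distrib)
  finally show ?thesis by simp
qed

text \<open>Any antisymmetric signing sums to 0 over \<open>A\<close>, and a sum of signs has the
  parity of the number of its terms.\<close>

lemma even_card_closed:
  assumes "finite A" "A \<subseteq> support f" "f ` A \<subseteq> A"
  shows "even (card A)"
proof -
  obtain \<omega> where \<omega>: "\<omega> \<in> antisym_signs f" using antisym_signs_nonempty by blast
  have "(\<Sum>t\<in>A. \<omega> t) = (\<Sum>t\<in>A. \<omega> (f t))"
    using assms(3) by (intro sum.reindex_bij_witness[of _ f f]) auto
  also have "\<dots> = - (\<Sum>t\<in>A. \<omega> t)"
    unfolding sum_negf[symmetric] using assms(2) \<omega>
    by (intro sum.cong) (auto simp: antisym_signs_def)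
  finally have "(\<Sum>t\<in>A. \<omega> t) = 0" by simp
  moreover have "even (\<Sum>t\<in>A. \<omega> t - 1)"
    using assms(2) \<omega> by (intro dvd_sum) (auto simp: antisym_signs_def)
  ultimately show ?thesis by (simp add: sum_subtractf)
qed

end

section \<open>Neighbourhoods, double counting and cuts\<close>

definition nbrs :: "'a set set \<Rightarrow> 'a \<Rightarrow> 'a set" where
  "nbrs E v = {w. {v, w} \<in> E}"

text \<open>A matching is encoded by the involution that swaps the ends of each matching edge and
  fixes the exposed vertices.\<close>

definition matching :: "'a set set \<Rightarrow> ('a \<Rightarrow> 'a) \<Rightarrow> bool" where
  "matching E f \<longleftrightarrow> (\<forall>v. f (f v) = v) \<and> (\<forall>v. f v \<noteq> v \<longrightarrow> {v, f v} \<in> E)"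

text \<open>For a maximum matching, these are the exposed vertices whose sum of random neighbour
  signs is identically 0.\<close>

definition closed_exposed :: "'a set \<Rightarrow> 'a set set \<Rightarrow> ('a \<Rightarrow> 'a) \<Rightarrow> 'a set" where
  "closed_exposed V E f = {v \<in> V. f v = v \<and> f ` nbrs E v \<subseteq> nbrs E v}"

lemma nbrs_sym: "w \<in> nbrs E v \<longleftrightarrow> v \<in> nbrs E w"
  by (simp add: nbrs_def insert_commute)

locale fin_graph =
  fixes V :: "'a set" and E :: "'a set set"
  assumes graph: "simple_graph V E"
begin

lemma finite_V: "finite V"
  using graph by (simp add: simple_graph_def)

lemma finite_E: "finite E"
  by (rule finite_subset[of _ "Pow V"]) (use graph in \<open>auto simp: simple_graph_def\<close>)

lemma nbrs_subset: "nbrs E v \<subseteq> V"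
  using graph by (auto simp: nbrs_def simple_graph_def)

lemma finite_nbrs: "finite (nbrs E v)"
  using finite_subset[OF nbrs_subset finite_V] .

lemma not_self_nbr: "v \<notin> nbrs E v"
  using graph by (auto simp: nbrs_def simple_graph_def)

lemma edge_pair: "e \<in> E \<Longrightarrow> v \<in> e \<Longrightarrow> \<exists>w. e = {v, w}"
  using graph unfolding simple_graph_def by (metis card_2_iff insert_commute insert_iff singletonD)

lemma bij_betw_nbrs: "bij_betw (\<lambda>w. {v, w}) (nbrs E v) {e \<in> E. v \<in> e}"
proof -
  have "inj_on (\<lambda>w. {v, w}) (nbrs E v)"
    by (auto simp: inj_on_def doubleton_eq_iff)
  moreover have "(\<lambda>w. {v, w}) ` nbrs E v = {e \<in> E. v \<in> e}"
    using edge_pair[of _ v] by (auto simp: nbrs_def)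
  ultimately show ?thesis by (simp add: bij_betw_def)
qed

lemma degree_eq_card_nbrs: "degree E v = card (nbrs E v)"
  unfolding degree_def using bij_betw_same_card[OF bij_betw_nbrs] by metis

text \<open>The weight \<open>h\<close> allows two uses: constant 1 for the degree sum, and 1 or -1
  according to the cut.\<close>

lemma handshake:
  fixes h :: "'a set \<Rightarrow> int"
  shows "(\<Sum>v\<in>V. \<Sum>w\<in>nbrs E v. h {v, w}) = 2 * (\<Sum>e\<in>E. h e)"
proof -
  have "(\<Sum>v\<in>V. \<Sum>w\<in>nbrs E v. h {v, w}) = (\<Sum>v\<in>V. \<Sum>e | e \<in> E \<and> v \<in> e. h e)"
    by (intro sum.cong refl sum.reindex_bij_betw[OF bij_betw_nbrs])
  also have "\<dots> = (\<Sum>e\<in>E. \<Sum>v | v \<in> V \<and> v \<in> e. h e)"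
    by (rule sum.swap_restrict[OF finite_V finite_E])
  also have "\<dots> = (\<Sum>e\<in>E. 2 * h e)"
  proof (rule sum.cong[OF refl])
    fix e assume e: "e \<in> E"
    then have "{v. v \<in> V \<and> v \<in> e} = e" "card e = 2"
      using graph by (auto simp: simple_graph_def)
    then show "(\<Sum>v | v \<in> V \<and> v \<in> e. h e) = 2 * h e" by simp
  qed
  finally show ?thesis by (simp add: sum_distrib_left)
qed

lemma sum_degree: "(\<Sum>v\<in>V. int (card (nbrs E v))) = 2 * int (card E)"
  using handshake[of "\<lambda>_. 1"] by simp

text \<open>Seen from each of its two ends, a cut edge contributes -1 and any other edge 1. A small
  sum thus means a large cut.\<close>

lemma sum_signs_cut_size:
  fixes \<tau> :: "'a \<Rightarrow> int"
  assumes "\<And>v. v \<in> V \<Longrightarrow> \<tau> v \<in> {1, -1}"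
  shows "(\<Sum>v\<in>V. \<Sum>w\<in>nbrs E v. \<tau> v * \<tau> w)
    = 2 * int (card E) - 4 * int (cut_size E {v \<in> V. \<tau> v = 1} {v \<in> V. \<tau> v = -1})"
proof -
  define cut where
    "cut e \<longleftrightarrow> (\<exists>x\<in>{v \<in> V. \<tau> v = 1}. \<exists>y\<in>{v \<in> V. \<tau> v = -1}. e = {x, y})" for e
  define h :: "'a set \<Rightarrow> int" where "h e = 1 - 2 * (if cut e then 1 else 0)" for e
  have "\<tau> v * \<tau> w = h {v, w}" if "v \<in> V" "w \<in> nbrs E v" for v w
  proof -
    have w: "w \<in> V" using that nbrs_subset by blast
    have "cut {v, w} \<longleftrightarrow> \<tau> v \<noteq> \<tau> w"
      using assms[OF that(1)] assms[OF w] that(1) w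
      by (auto simp: cut_def doubleton_eq_iff)
    then show ?thesis using assms[OF that(1)] assms[OF w] by (auto simp: h_def)
  qed
  then have "(\<Sum>v\<in>V. \<Sum>w\<in>nbrs E v. \<tau> v * \<tau> w) = (\<Sum>v\<in>V. \<Sum>w\<in>nbrs E v. h {v, w})"
    by (intro sum.cong) auto
  also have "\<dots> = 2 * (\<Sum>e\<in>E. h e)" by (rule handshake)
  also have "(\<Sum>e\<in>E. h e) = int (card E) - 2 * (\<Sum>e\<in>E. if cut e then 1 else 0)"
    by (simp add: h_def sum_subtractf sum_distrib_left)
  also have "(\<Sum>e\<in>E. if cut e then 1 else 0 :: int) = int (card {e \<in> E. cut e})"
    using finite_E by (simp add: sum.If_cases Int_def)
  finally show ?thesis by (simp add: cut_size_def cut_def)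
qed

lemma matching_support: "matching E f \<Longrightarrow> support f \<subseteq> V"
  using graph unfolding matching_def support_def simple_graph_def by blast

lemma matching_mate_nbr: "matching E f \<Longrightarrow> t \<in> support f \<Longrightarrow> f t \<in> nbrs E t"
  by (auto simp: matching_def support_def nbrs_def)

lemma matching_invol: "matching E f \<Longrightarrow> f (f v) = v"
  by (simp add: matching_def)

lemma matching_finite_involution: "matching E f \<Longrightarrow> finite_involution f"
  using finite_subset[OF matching_support finite_V]
  by unfold_locales (auto simp: matching_def)

section \<open>Maximum matchings and their exposed vertices\<close>

text \<open>The support has two elements for each matching edge, so its size measures the
  matching.\<close>

definition maximum_matching :: "('a \<Rightarrow> 'a) \<Rightarrow> bool" where
  "maximum_matching f \<longleftrightarrow> matching E f
    \<and> (\<forall>g. matching E g \<longrightarrow> card (support g) \<le> card (support f))"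

lemma exposed_not_adjacent:
  assumes "maximum_matching f" "f v = v" "f w = w"
  shows "w \<notin> nbrs E v"
proof
  assume vw: "w \<in> nbrs E v"
  then have ne: "v \<noteq> w" using not_self_nbr by blast
  let ?g = "f(v := w, w := v)"
  have f: "matching E f" using assms(1) by (simp add: maximum_matching_def)
  have inv: "\<And>u. f (f u) = u" by (rule matching_invol[OF f])
  have g: "matching E ?g"
    unfolding matching_def
  proof (intro conjI allI impI)
    show "?g (?g u) = u" for u
      using inv assms(2,3) ne by (auto simp: fun_upd_def)
    show "{u, ?g u} \<in> E" if "?g u \<noteq> u" for u
      using that vw f by (auto simp: nbrs_def matching_def insert_commute)
  qed
  have "support f \<subset> support ?g"
    using assms(2,3) ne by (auto simp: support_def)
  then have "card (support f) < card (support ?g)"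
    using finite_subset[OF matching_support[OF g] finite_V] by (rule psubset_card_mono[rotated])
  then show False using g assms(1) by (auto simp: maximum_matching_def)
qed

lemma no_augmenting_path:
  assumes "maximum_matching f" "f v = v" "f w = w" "v \<noteq> w" "t \<in> nbrs E v" "f t \<in> nbrs E w"
  shows False
proof -
  have f: "matching E f" using assms(1) by (simp add: maximum_matching_def)
  have inv: "\<And>u. f (f u) = u" by (rule matching_invol[OF f])
  have t: "f t \<noteq> t" using exposed_not_adjacent[OF assms(1,2)] assms(5) by blast
  have ne: "v \<noteq> t" "v \<noteq> f t" "w \<noteq> t" "w \<noteq> f t"
    using t assms(2,3) inv by metis+
  \<comment> \<open>Augmentation along the path \<open>v\<close>, \<open>t\<close>,
    \<open>f t\<close>, \<open>w\<close>: its outer edges replace the middle one.\<close>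
  let ?g = "f(v := t, t := v, w := f t, f t := w)"
  have g: "matching E ?g"
    unfolding matching_def
  proof (intro conjI allI impI)
    show "?g (?g u) = u" for u
      using inv[of u] inv[of t] assms(2-4) ne t
      by (auto simp: fun_upd_def)
    show "{u, ?g u} \<in> E" if "?g u \<noteq> u" for u
      using that assms(5,6) f by (auto simp: nbrs_def matching_def insert_commute)
  qed
  have "support f \<subset> support ?g"
    using assms(2-4) ne t by (auto simp: support_def)
  then have "card (support f) < card (support ?g)"
    using finite_subset[OF matching_support[OF g] finite_V] by (rule psubset_card_mono[rotated])
  then show False using g assms(1) by (auto simp: maximum_matching_def)
qed

lemma exposed_nbrs_matched:
  assumes "maximum_matching f" "f v = v"
  shows "nbrs E v \<subseteq> support f"
  using exposed_not_adjacent[OF assms] by (auto simp: support_def)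

lemma finite_closed_exposed: "finite (closed_exposed V E f)"
  using finite_V by (simp add: closed_exposed_def)

text \<open>Closedness puts \<open>f t\<close> next to \<open>z'\<close> as well, so distinct
  \<open>z\<close> and \<open>z'\<close> would be the ends of an augmenting path through
  \<open>t\<close> and \<open>f t\<close>.\<close>

lemma closed_exposed_unique:
  assumes "maximum_matching f" "z \<in> closed_exposed V E f" "z' \<in> closed_exposed V E f"
    "t \<in> nbrs E z" "t \<in> nbrs E z'"
  shows "z = z'"
  using no_augmenting_path[OF assms(1), of z z' t] assms(2-5) by (auto simp: closed_exposed_def)

text \<open>If the degree were odd, exchange the exposed vertex \<open>z\<close> with \<open>t\<close>: the neighbourhood of the newly exposed
  vertex \<open>t\<close> has odd size, so it is not a union of matching edges.\<close>

lemma even_degree_at_closed_exposed: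
  assumes max: "maximum_matching f"
    and min: "\<And>g. maximum_matching g
           \<Longrightarrow> card (closed_exposed V E f) \<le> card (closed_exposed V E g)"
    and z: "z \<in> closed_exposed V E f" and tz: "t \<in> nbrs E z"
  shows "even (card (nbrs E t))"
proof (rule ccontr)
  assume odd: "odd (card (nbrs E t))"
  have f: "matching E f" using max by (simp add: maximum_matching_def)
  have inv: "\<And>u. f (f u) = u" by (rule matching_invol[OF f])
  have fz: "f z = z" "z \<in> V" using z by (auto simp: closed_exposed_def)
  have t: "f t \<noteq> t" using exposed_not_adjacent[OF max fz(1)] tz by blast
  have ftz: "f t \<in> nbrs E z" using z tz by (auto simp: closed_exposed_def)
  have ne: "z \<noteq> t" "z \<noteq> f t" using t fz inv by metis+
  \<comment> \<open>The edge \<open>{z, f t}\<close> replaces \<open>{t, f t}\<close>: the size is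
    kept, \<open>z\<close> becomes matched and \<open>t\<close> exposed.\<close>
  let ?g = "f(z := f t, f t := z, t := t)"
  have g: "matching E ?g"
    unfolding matching_def
  proof (intro conjI allI impI)
    show "?g (?g u) = u" for u
      using inv[of u] inv[of t] fz ne t by (auto simp: fun_upd_def)
    show "{u, ?g u} \<in> E" if "?g u \<noteq> u" for u
      using that ftz f by (auto simp: nbrs_def matching_def insert_commute split: if_splits)
  qed
  have supp: "support ?g = insert z (support f - {t})"
    using fz ne t inv[of t] by (auto simp: support_def)
  have "t \<in> support f" "z \<notin> support f" "finite (support f)"
    using t fz finite_subset[OF matching_support[OF f] finite_V] by (auto simp: support_def)
  then have "card (support ?g) = card (support f)"
    unfolding supp by (metis Diff_iff card.remove card_insert_disjoint finite_Diff)
  then have gmax: "maximum_matching ?g"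
    using g max by (simp add: maximum_matching_def)
  have gt: "?g t = t" by simp
  have "t \<notin> closed_exposed V E ?g"
  proof
    assume "t \<in> closed_exposed V E ?g"
    then have "?g ` nbrs E t \<subseteq> nbrs E t" by (simp add: closed_exposed_def)
    then have "even (card (nbrs E t))"
      by (rule finite_involution.even_card_closed[OF matching_finite_involution[OF g] finite_nbrs
          exposed_nbrs_matched[OF gmax gt]])
    then show False using odd by blast
  qed
  moreover have "z \<notin> closed_exposed V E ?g"
    using ne fz by (auto simp: closed_exposed_def)
  \<comment> \<open>No new closed exposed vertex arises: maximality keeps \<open>z\<close>,
    \<open>t\<close> and \<open>f t\<close> out of the neighbourhood of \<open>w\<close>, and
    \<open>f\<close> and \<open>?g\<close> agree everywhere else.\<close>
  moreover have "w \<in> closed_exposed V E f" if w: "w \<in> closed_exposed V E ?g" "w \<noteq> t" for w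
  proof -
    have wz: "w \<noteq> z" using w(1) calculation(2) by blast
    have wft: "w \<noteq> f t" using w(1) ne t by (auto simp: closed_exposed_def)
    have fw: "f w = w" "w \<in> V" using w wz wft by (auto simp: closed_exposed_def)
    have "z \<notin> nbrs E w" using exposed_not_adjacent[OF max fw(1) fz(1)] .
    moreover have "t \<notin> nbrs E w"
      using no_augmenting_path[OF max fw(1) fz(1) wz _ ftz] by blast
    moreover have "f t \<notin> nbrs E w"
      using no_augmenting_path[OF max fw(1) fz(1) wz, of "f t"] inv tz by auto
    ultimately have "?g u = f u" if "u \<in> nbrs E w" for u using that by auto
    then have "f ` nbrs E w = ?g ` nbrs E w" by (intro image_cong) auto
    then show ?thesis using w fw by (simp add: closed_exposed_def)
  qed
  ultimately have "closed_exposed V E ?g \<subset> closed_exposed V E f" using z by blast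
  then have "card (closed_exposed V E ?g) < card (closed_exposed V E f)"
    by (rule psubset_card_mono[OF finite_closed_exposed])
  then show False using min[OF gmax] by simp
qed

lemma exists_good_matching:
  obtains f where "maximum_matching f"
    "\<And>g. maximum_matching g \<Longrightarrow> card (closed_exposed V E f) \<le> card (closed_exposed V E g)"
proof -
  have id: "matching E id" by (simp add: matching_def)
  have bound: "\<forall>g. matching E g \<longrightarrow> card (support g) < Suc (card V)"
    using matching_support finite_V card_mono by (metis less_Suc_eq_le)
  obtain f where f: "maximum_matching f"
    using Lattices_Big.ex_has_greatest_nat[OF id bound] by (auto simp: maximum_matching_def)
  show ?thesis
    using ex_has_least_nat[of maximum_matching f "\<lambda>g. card (closed_exposed V E g)", OF f] that
    by auto
qed

text \<open>Double counting of the edges between closed exposed and matched vertices. A matched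
  \<open>t\<close> meets at most one such \<open>z\<close>; if it meets one, its degree is even, so
  it stays below the odd \<open>r\<close> and leaves a slack of at least 1.\<close>

lemma sum_degree_closed_exposed:
  assumes r: "odd r" "\<And>v. v \<in> V \<Longrightarrow> card (nbrs E v) \<le> r"
    and max: "maximum_matching f"
    and min: "\<And>g. maximum_matching g
           \<Longrightarrow> card (closed_exposed V E f) \<le> card (closed_exposed V E g)"
  shows "(\<Sum>z\<in>closed_exposed V E f. int (card (nbrs E z)))
    \<le> (\<Sum>t\<in>support f. int r - int (card (nbrs E t)))"
proof -
  let ?Z = "closed_exposed V E f"
  have f: "matching E f" using max by (simp add: maximum_matching_def)
  have finT: "finite (support f)" using finite_subset[OF matching_support[OF f] finite_V] .
  have "(\<Sum>z\<in>?Z. int (card (nbrs E z))) = (\<Sum>z\<in>?Z. \<Sum>t | t \<in> support f \<and> t \<in> nbrs E z. 1)"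
  proof (intro sum.cong refl)
    fix z assume "z \<in> ?Z"
    then have "{t. t \<in> support f \<and> t \<in> nbrs E z} = nbrs E z"
      using exposed_nbrs_matched[OF max, of z] by (auto simp: closed_exposed_def)
    then show "int (card (nbrs E z)) = (\<Sum>t | t \<in> support f \<and> t \<in> nbrs E z. 1)" by simp
  qed
  also have "\<dots> = (\<Sum>t\<in>support f. \<Sum>z | z \<in> ?Z \<and> t \<in> nbrs E z. 1)"
    by (rule sum.swap_restrict[OF finite_closed_exposed finT])
  also have "\<dots> \<le> (\<Sum>t\<in>support f. int r - int (card (nbrs E t)))"
  proof (rule sum_mono)
    fix t assume "t \<in> support f"
    then have tV: "t \<in> V" using matching_support[OF f] by blast
    show "(\<Sum>z | z \<in> ?Z \<and> t \<in> nbrs E z. 1) \<le> int r - int (card (nbrs E t))"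
    proof (cases "\<exists>z\<in>?Z. t \<in> nbrs E z")
      case True
      then obtain z where z: "z \<in> ?Z" "t \<in> nbrs E z" by blast
      then have "{z. z \<in> ?Z \<and> t \<in> nbrs E z} = {z}"
        using closed_exposed_unique[OF max] by blast
      moreover have "even (card (nbrs E t))"
        using even_degree_at_closed_exposed[OF max min z] .
      then have "card (nbrs E t) \<noteq> r" using r(1) by blast
      then have "card (nbrs E t) < r" using r(2)[OF tV] by simp
      ultimately show ?thesis by simp
    next
      case False
      then have "{z. z \<in> ?Z \<and> t \<in> nbrs E z} = {}" by blast
      then show ?thesis using r(2)[OF tV] by (simp only: sum.empty)
    qed
  qed
  finally show ?thesis .
qed

section \<open>The balanced cut for an odd degree bound\<close>

text \<open>Let \<open>N = card T + card (I - Z)\<close>. The signed edge sum \<open>F\<close> has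
  mean at most \<open>- N\<close>, while \<open>2 * card E \<le> r * N\<close>. Some outcome
  therefore has \<open>F \<le> - 2 * card E / r\<close>, and \<open>F\<close> is
  \<open>2 * card E\<close> minus four times the cut.\<close>

lemma exists_balanced_cut_odd:
  assumes r: "odd r" "\<And>v. v \<in> V \<Longrightarrow> card (nbrs E v) \<le> r"
  obtains V1 V2 where "bipartition V V1 V2"
    "2 * \<bar>int (card V1) - int (card V2)\<bar> \<le> int r + 1"
    "2 * int r * int (cut_size E V1 V2) \<ge> (int r + 1) * int (card E)"
proof -
  obtain f where max: "maximum_matching f"
    and min: "\<And>g. maximum_matching g
           \<Longrightarrow> card (closed_exposed V E f) \<le> card (closed_exposed V E g)"
    using exists_good_matching by blast
  have f: "matching E f" using max by (simp add: maximum_matching_def)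
  interpret finite_involution f by (rule matching_finite_involution[OF f])
  define T where "T = support f"
  define I where "I = V - T"
  define \<Omega> where "\<Omega> = antisym_signs f"
  \<comment> \<open>Writing every \<open>X \<omega> v\<close> as a form over all of \<open>T\<close>
    makes differences linear forms too, so the dichotomy applies to them.\<close>
  define c :: "'a \<Rightarrow> 'a \<Rightarrow> int" where "c v t = (if t \<in> nbrs E v then 1 else 0)" for v t
  define X where "X \<omega> v = (\<Sum>t\<in>T. c v t * \<omega> t)" for \<omega> v
  have T: "T \<subseteq> V" "finite T" unfolding T_def by (rule matching_support[OF f], rule finite_support)
  have I: "finite I" "V = T \<union> I" "T \<inter> I = {}" "\<And>v. v \<in> I \<Longrightarrow> f v = v"
    using finite_V T by (auto simp: I_def T_def support_def)
  have \<Omega>: "finite \<Omega>" "\<Omega> \<noteq> {}" "\<And>\<omega> t. \<omega> \<in> \<Omega> \<Longrightarrow> t \<in> T \<Longrightarrow> \<omega> t \<in> {1, -1}"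
    unfolding \<Omega>_def T_def using finite_antisym_signs antisym_signs_nonempty
    by (auto simp: antisym_signs_def)
  then have \<Omega>0: "card \<Omega> > 0" by (simp add: card_gt_0_iff)
  have nb: "nbrs E v \<subseteq> T" if "v \<in> I" for v
    unfolding T_def using exposed_nbrs_matched[OF max I(4)[OF that]] .
  have X_nbrs: "X \<omega> v = (\<Sum>t\<in>nbrs E v. \<omega> t)" if "v \<in> I" for \<omega> v
  proof -
    have "X \<omega> v = (\<Sum>t\<in>T. if t \<in> nbrs E v then \<omega> t else 0)"
      unfolding X_def c_def by (intro sum.cong) auto
    also have "\<dots> = (\<Sum>t\<in>nbrs E v. \<omega> t)"
      using nb[OF that] T(2) by (intro sum.mono_neutral_cong_right) auto
    finally show ?thesis .
  qed
  have mean_abs: "int (card \<Omega>) \<le> (\<Sum>\<omega>\<in>\<Omega>. \<bar>\<Sum>t\<in>T. d t * \<omega> t\<bar>)"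
    if "\<exists>\<omega>\<in>\<Omega>. (\<Sum>t\<in>T. d t * \<omega> t) \<noteq> 0" for d
    using that linear_form_zero[of _ d] linear_form_mean_abs[of _ d] unfolding \<Omega>_def T_def by blast
  have symmetric: "d t = d (f t)"
    if "\<forall>\<omega>\<in>\<Omega>. (\<Sum>t\<in>T. d t * \<omega> t) = 0" "t \<in> T" for d t
  proof (rule ccontr)
    assume "d t \<noteq> d (f t)"
    then have "int (card \<Omega>) \<le> (\<Sum>\<omega>\<in>\<Omega>. \<bar>\<Sum>t\<in>T. d t * \<omega> t\<bar>)"
      using linear_form_mean_abs[of t d] that(2) unfolding \<Omega>_def T_def by blast
    then show False using that(1) \<Omega>0 by simp
  qed
  have diff: "X \<omega> v - X \<omega> w = (\<Sum>t\<in>T. (c v t - c w t) * \<omega> t)" for \<omega> v w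
    by (simp add: X_def sum_subtractf algebra_simps)
  have h1: "int (card \<Omega>) \<le> (\<Sum>\<omega>\<in>\<Omega>. \<bar>X \<omega> v - X \<omega> w\<bar>)"
    if "\<exists>\<omega>\<in>\<Omega>. X \<omega> v \<noteq> X \<omega> w" for v w
    using mean_abs[of "\<lambda>t. c v t - c w t"] that unfolding diff[symmetric] by simp
  have h2: "int (card \<Omega>) \<le> (\<Sum>\<omega>\<in>\<Omega>. \<bar>X \<omega> v\<bar>)"
    if "\<exists>\<omega>\<in>\<Omega>. X \<omega> v \<noteq> 0" for v
    using mean_abs[of "c v"] that unfolding X_def .
  \<comment> \<open>Vertices with the same linear form share a neighbour whose mate is not adjacent to them.\<close>
  have h3: "card {w \<in> I. \<forall>\<omega>\<in>\<Omega>. X \<omega> w = X \<omega> v} < r"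
    if v: "\<exists>\<omega>\<in>\<Omega>. X \<omega> v \<noteq> 0" for v
  proof -
    obtain t0 where t0: "t0 \<in> T" "c v t0 \<noteq> c v (f t0)"
      using v linear_form_zero[of _ "c v"] unfolding \<Omega>_def T_def X_def by blast
    obtain t where t: "t \<in> T" "t \<in> nbrs E v" "f t \<notin> nbrs E v"
    proof (cases "t0 \<in> nbrs E v")
      case True
      then show ?thesis using t0 that[of t0] by (auto simp: c_def split: if_splits)
    next
      case False
      then show ?thesis using t0 that[of "f t0"] by (auto simp: c_def T_def split: if_splits)
    qed
    have ft: "f t \<in> nbrs E t" using matching_mate_nbr[OF f] t(1) by (simp add: T_def)
    have "w \<in> nbrs E t - {f t}" if w: "w \<in> I" "\<forall>\<omega>\<in>\<Omega>. X \<omega> w = X \<omega> v" for w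
    proof -
      \<comment> \<open>As \<open>c v t = 1\<close> and \<open>c v (f t) = 0\<close>, this says
        \<open>c w t = 1 + c w (f t)\<close>, which forces \<open>c w t = 1\<close>.\<close>
      have "c v t - c w t = c v (f t) - c w (f t)"
        using symmetric[of "\<lambda>t. c v t - c w t" t] w(2) t(1) unfolding diff[symmetric] by simp
      then have "t \<in> nbrs E w" using t by (auto simp: c_def split: if_splits)
      moreover have "f t \<in> T" using t(1) by (simp add: T_def)
      then have "w \<noteq> f t" using w(1) I(3) by blast
      ultimately show ?thesis using nbrs_sym[of t E w] by blast
    qed
    then have "card {w \<in> I. \<forall>\<omega>\<in>\<Omega>. X \<omega> w = X \<omega> v} \<le> card (nbrs E t - {f t})"
      using finite_nbrs by (intro card_mono) auto
    \<comment> \<open>Discarding the mate \<open>f t\<close>, a neighbour of \<open>t\<close>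
      outside \<open>I\<close>, makes the bound strict.\<close>
    also have "\<dots> < card (nbrs E t)" using ft finite_nbrs by (metis card_Diff1_less)
    also have "\<dots> \<le> r" using r(2) t(1) T(1) by blast
    finally show ?thesis .
  qed
  define Z where "Z = closed_exposed V E f"
  have Z: "Z \<subseteq> I" unfolding Z_def closed_exposed_def I_def T_def support_def by auto
  have active: "I - Z \<subseteq> {v \<in> I. \<exists>\<omega>\<in>\<Omega>. X \<omega> v \<noteq> 0}"
  proof
    fix v assume v: "v \<in> I - Z"
    have "v \<in> Z" if zero: "\<forall>\<omega>\<in>\<Omega>. X \<omega> v = 0"
    proof -
      have "f t \<in> nbrs E v" if "t \<in> nbrs E v" for t
        using symmetric[of "c v" t] zero that nb[of v] v unfolding X_def[symmetric]
        by (auto simp: c_def split: if_splits)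
      then show ?thesis using v I by (auto simp: Z_def closed_exposed_def)
    qed
    then show "v \<in> {v \<in> I. \<exists>\<omega>\<in>\<Omega>. X \<omega> v \<noteq> 0}" using v by blast
  qed
  obtain \<tau> where \<tau>: "\<And>\<omega> v. \<tau> \<omega> v \<in> {1, -1}"
      "\<And>\<omega>. 2 * \<bar>\<Sum>v\<in>I. \<tau> \<omega> v\<bar> \<le> int r + 1"
      "2 * (\<Sum>\<omega>\<in>\<Omega>. \<Sum>v\<in>I. \<tau> \<omega> v * X \<omega> v)
        \<le> - int (card \<Omega>) * int (card {v \<in> I. \<exists>\<omega>\<in>\<Omega>. X \<omega> v \<noteq> 0})"
    using exists_balanced_signing[of I r \<Omega> X] I(1) r(1) h1 h2 h3 by blast
  define \<sigma> where "\<sigma> \<omega> v = (if v \<in> T then \<omega> v else \<tau> \<omega> v)" for \<omega> v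
  have \<sigma>: "\<sigma> \<omega> v \<in> {1, -1}" if "\<omega> \<in> \<Omega>" for \<omega> v
    using \<Omega>(3)[OF that] \<tau>(1)[of \<omega> v] by (auto simp: \<sigma>_def)
  define F where "F \<omega> = (\<Sum>v\<in>V. \<Sum>w\<in>nbrs E v. \<sigma> \<omega> v * \<sigma> \<omega> w)" for \<omega>
  \<comment> \<open>No edge joins two vertices of \<open>I\<close>, and each edge between
    \<open>T\<close> and \<open>I\<close> is counted from both ends; hence the factor 2.\<close>
  have split: "F \<omega> = (\<Sum>v\<in>T. \<Sum>w\<in>nbrs E v \<inter> T. \<omega> v * \<omega> w) + 2 * (\<Sum>v\<in>I. \<tau> \<omega> v * X \<omega> v)"
    for \<omega>
  proof -
    let ?g = "\<lambda>v w. \<sigma> \<omega> v * \<sigma> \<omega> w"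
    have dist: "(\<Sum>v\<in>I. \<tau> \<omega> v * X \<omega> v) = (\<Sum>v\<in>I. \<Sum>w\<in>nbrs E v. ?g v w)"
    proof (intro sum.cong refl)
      fix v assume v: "v \<in> I"
      then have "v \<notin> T" using I(3) by blast
      then show "\<tau> \<omega> v * X \<omega> v = (\<Sum>w\<in>nbrs E v. ?g v w)"
        unfolding X_nbrs[OF v] sum_distrib_left using nb[OF v]
        by (intro sum.cong) (auto simp: \<sigma>_def)
    qed
    have "(\<Sum>v\<in>I. \<Sum>w\<in>nbrs E v. ?g v w) = (\<Sum>v\<in>I. \<Sum>w | w \<in> T \<and> w \<in> nbrs E v. ?g v w)"
      using nb by (intro sum.cong) auto
    also have "\<dots> = (\<Sum>w\<in>T. \<Sum>v | v \<in> I \<and> w \<in> nbrs E v. ?g v w)"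
      by (rule sum.swap_restrict[OF I(1) T(2)])
    also have "\<dots> = (\<Sum>w\<in>T. \<Sum>v\<in>nbrs E w \<inter> I. ?g w v)"
      by (intro sum.cong) (auto simp: nbrs_sym[of _ E] mult.commute)
    finally have cross: "(\<Sum>v\<in>I. \<Sum>w\<in>nbrs E v. ?g v w) = (\<Sum>w\<in>T. \<Sum>v\<in>nbrs E w \<inter> I. ?g w v)" .
    have parts: "(\<Sum>w\<in>nbrs E v. ?g v w) = (\<Sum>w\<in>nbrs E v \<inter> T. ?g v w) + (\<Sum>w\<in>nbrs E v \<inter> I. ?g v w)"
      for v
    proof -
      have "nbrs E v = (nbrs E v \<inter> T) \<union> (nbrs E v \<inter> I)" using nbrs_subset[of v] I(2) by blast
      moreover have "(nbrs E v \<inter> T) \<inter> (nbrs E v \<inter> I) = {}" using I(3) by blast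
      ultimately show ?thesis using sum.union_disjoint finite_nbrs finite_Int by metis
    qed
    have "(\<Sum>v\<in>T. \<Sum>w\<in>nbrs E v. ?g v w)
        = (\<Sum>v\<in>T. \<Sum>w\<in>nbrs E v \<inter> T. ?g v w) + (\<Sum>v\<in>I. \<tau> \<omega> v * X \<omega> v)"
      unfolding dist cross unfolding parts sum.distrib by (rule refl)
    moreover have "(\<Sum>v\<in>T. \<Sum>w\<in>nbrs E v \<inter> T. ?g v w)
        = (\<Sum>v\<in>T. \<Sum>w\<in>nbrs E v \<inter> T. \<omega> v * \<omega> w)"
      by (intro sum.cong) (auto simp: \<sigma>_def)
    moreover have "F \<omega> = (\<Sum>v\<in>T. \<Sum>w\<in>nbrs E v. ?g v w) + (\<Sum>v\<in>I. \<Sum>w\<in>nbrs E v. ?g v w)"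
      unfolding F_def using I T by (simp add: sum.union_disjoint)
    ultimately show ?thesis by (simp add: dist)
  qed
  \<comment> \<open>Only the mate of \<open>v\<close> is correlated with \<open>v\<close>.\<close>
  have matched: "(\<Sum>\<omega>\<in>\<Omega>. \<Sum>w\<in>nbrs E v \<inter> T. \<omega> v * \<omega> w) = - int (card \<Omega>)" if v: "v \<in> T" for v
  proof -
    have "(\<Sum>\<omega>\<in>\<Omega>. \<Sum>w\<in>nbrs E v \<inter> T. \<omega> v * \<omega> w) = (\<Sum>w\<in>nbrs E v \<inter> T. \<Sum>\<omega>\<in>\<Omega>. \<omega> v * \<omega> w)"
      by (rule sum.swap)
    also have "\<dots> = (\<Sum>w\<in>nbrs E v \<inter> T. if w = f v then - int (card \<Omega>) else 0)"
      using v not_self_nbr[of v] unfolding \<Omega>_def T_def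
      by (intro sum.cong) (auto simp: sum_sign_product)
    also have "\<dots> = - int (card \<Omega>)"
      using matching_mate_nbr[OF f, of v] v finite_nbrs[of v] by (simp add: T_def)
    finally show ?thesis .
  qed
  have "(\<Sum>\<omega>\<in>\<Omega>. \<Sum>v\<in>T. \<Sum>w\<in>nbrs E v \<inter> T. \<omega> v * \<omega> w) = - int (card \<Omega>) * int (card T)"
    by (subst sum.swap) (simp add: matched)
  then have "(\<Sum>\<omega>\<in>\<Omega>. F \<omega>) = - int (card \<Omega>) * int (card T)
      + 2 * (\<Sum>\<omega>\<in>\<Omega>. \<Sum>v\<in>I. \<tau> \<omega> v * X \<omega> v)"
    by (simp add: split sum.distrib sum_distrib_left)
  also have "\<dots> \<le> - int (card \<Omega>) * int (card T) + - int (card \<Omega>) * int (card (I - Z))"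
  proof -
    have "card (I - Z) \<le> card {v \<in> I. \<exists>\<omega>\<in>\<Omega>. X \<omega> v \<noteq> 0}"
      using active I(1) by (intro card_mono) auto
    then have "int (card \<Omega>) * int (card (I - Z))
        \<le> int (card \<Omega>) * int (card {v \<in> I. \<exists>\<omega>\<in>\<Omega>. X \<omega> v \<noteq> 0})"
      by (intro mult_left_mono) auto
    then show ?thesis using \<tau>(3) by linarith
  qed
  finally have "(\<Sum>\<omega>\<in>\<Omega>. F \<omega>) \<le> (\<Sum>\<omega>\<in>\<Omega>. - (int (card T) + int (card (I - Z))))"
    by (simp add: algebra_simps)
  then obtain \<omega> where \<omega>: "\<omega> \<in> \<Omega>" "F \<omega> \<le> - (int (card T) + int (card (I - Z)))"
    using sum_strict_mono[OF \<Omega>(1,2), of "\<lambda>_. - (int (card T) + int (card (I - Z)))" F]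
    by (meson not_le)
  \<comment> \<open>The degrees over \<open>Z\<close> fit into the slack of the degrees over
    \<open>T\<close>, so \<open>T\<close> and \<open>Z\<close> together cost at most
    \<open>r * card T\<close>.\<close>
  have degrees: "2 * int (card E) \<le> int r * (int (card T) + int (card (I - Z)))"
  proof -
    have "2 * int (card E) = (\<Sum>v\<in>T \<union> I. int (card (nbrs E v)))"
      using sum_degree I(2) by simp
    also have "\<dots> = (\<Sum>v\<in>T. int (card (nbrs E v))) + ((\<Sum>v\<in>I - Z. int (card (nbrs E v)))
        + (\<Sum>v\<in>Z. int (card (nbrs E v))))"
      unfolding sum.union_disjoint[OF T(2) I(1,3)] sum.subset_diff[OF Z I(1)] by (rule refl)
    also have "(\<Sum>v\<in>I - Z. int (card (nbrs E v))) \<le> (\<Sum>v\<in>I - Z. int r)"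
      using r(2) I(2) by (intro sum_mono) auto
    also have "(\<Sum>v\<in>Z. int (card (nbrs E v))) \<le> (\<Sum>t\<in>T. int r - int (card (nbrs E t)))"
      using sum_degree_closed_exposed[OF r max min] by (simp add: Z_def T_def)
    finally show ?thesis by (simp add: sum_subtractf algebra_simps)
  qed
  define V1 where "V1 = {v \<in> V. \<sigma> \<omega> v = 1}"
  define V2 where "V2 = {v \<in> V. \<sigma> \<omega> v = -1}"
  have V12: "V1 \<union> V2 = V" "V1 \<inter> V2 = {}" "finite V1" "finite V2"
    using \<sigma>[OF \<omega>(1)] finite_V by (auto simp: V1_def V2_def)
  show thesis
  proof
    show "bipartition V V1 V2" using V12 by (simp add: bipartition_def)
    have "int (card V1) - int (card V2) = (\<Sum>v\<in>V1. \<sigma> \<omega> v) + (\<Sum>v\<in>V2. \<sigma> \<omega> v)"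
      by (simp add: V1_def V2_def)
    also have "\<dots> = (\<Sum>v\<in>V. \<sigma> \<omega> v)"
      using V12 sum.union_disjoint by metis
    also have "\<dots> = (\<Sum>v\<in>T. \<sigma> \<omega> v) + (\<Sum>v\<in>I. \<sigma> \<omega> v)"
      unfolding I(2) using I T by (simp add: sum.union_disjoint)
    \<comment> \<open>Mates cancel, so only the signs on \<open>I\<close> affect the
      balance.\<close>
    also have "(\<Sum>v\<in>T. \<sigma> \<omega> v) = 0"
      using linear_form_zero[of \<omega> "\<lambda>_. 1"] \<omega>(1) by (simp add: \<sigma>_def \<Omega>_def T_def)
    also have "(\<Sum>v\<in>I. \<sigma> \<omega> v) = (\<Sum>v\<in>I. \<tau> \<omega> v)"
      using I(3) by (intro sum.cong) (auto simp: \<sigma>_def)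
    finally show "2 * \<bar>int (card V1) - int (card V2)\<bar> \<le> int r + 1"
      using \<tau>(2)[of \<omega>] by simp
    have "F \<omega> = 2 * int (card E) - 4 * int (cut_size E V1 V2)"
      unfolding F_def V1_def V2_def by (rule sum_signs_cut_size) (rule \<sigma>[OF \<omega>(1)])
    then have "int (card T) + int (card (I - Z)) \<le> 4 * int (cut_size E V1 V2) - 2 * int (card E)"
      using \<omega>(2) by simp
    then have "int r * (int (card T) + int (card (I - Z)))
        \<le> int r * (4 * int (cut_size E V1 V2) - 2 * int (card E))"
      by (intro mult_left_mono) auto
    then show "2 * int r * int (cut_size E V1 V2) \<ge> (int r + 1) * int (card E)"
      using degrees by (simp add: algebra_simps)
  qed
qed

end

section \<open>Both parities of the degree bound\<close>

theorem theorem1p13: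
  fixes V :: "'a set" and E :: "'a set set" and r m :: nat
  assumes "r > 0"
    and "simple_graph V E"
    and "card E = m"
    and "max_degree V E \<le> r"
  shows "\<exists>V1 V2. bipartition V V1 V2
    \<and> \<bar>real (card V1) - real (card V2)\<bar> \<le> real r / 2 + 1
    \<and> (odd r \<longrightarrow> real (cut_size E V1 V2) \<ge> (real r + 1) / (2 * real r) * real m)
    \<and> (even r \<longrightarrow> real (cut_size E V1 V2) \<ge> (real r + 2) / (2 * (real r + 1)) * real m)"
proof -
  interpret fin_graph V E by unfold_locales (rule assms(2))
  have deg: "card (nbrs E v) \<le> r" if "v \<in> V" for v
  proof -
    have "degree E v \<le> max_degree V E"
      unfolding max_degree_def using that finite_V by (intro Max_ge) auto
    then show ?thesis using assms(4) by (simp add: degree_eq_card_nbrs)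
  qed
  \<comment> \<open>For even \<open>r\<close>, the odd bound \<open>s = r + 1\<close> turns
    \<open>(s + 1) / (2 * s)\<close> into \<open>(r + 2) / (2 * (r + 1))\<close>, and the imbalance
    \<open>(s + 1) / 2\<close> is exactly \<open>r / 2 + 1\<close>.\<close>
  define s where "s = (if odd r then r else r + 1)"
  have s: "odd s" "r \<le> s" "s > 0" using assms(1) by (auto simp: s_def)
  obtain V1 V2 where V12: "bipartition V V1 V2"
      "2 * \<bar>int (card V1) - int (card V2)\<bar> \<le> int s + 1"
      "2 * int s * int (cut_size E V1 V2) \<ge> (int s + 1) * int (card E)"
    using exists_balanced_cut_odd[OF s(1) order_trans[OF deg s(2)]] by blast
  have "real_of_int (2 * \<bar>int (card V1) - int (card V2)\<bar>) \<le> real_of_int (int s + 1)"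
    using V12(2) by (simp only: of_int_le_iff)
  then have bal: "\<bar>real (card V1) - real (card V2)\<bar> \<le> real r / 2 + 1"
    by (auto simp: s_def split: if_splits)
  have "real_of_int ((int s + 1) * int (card E)) \<le> real_of_int (2 * int s * int (cut_size E V1 V2))"
    using V12(3) by (simp only: of_int_le_iff)
  then have "(real s + 1) / (2 * real s) * real m \<le> real (cut_size E V1 V2)"
    using s(3) assms(3) by (simp add: field_simps)
  then show ?thesis
    using V12(1) bal by (intro exI[of _ V1] exI[of _ V2]) (auto simp: s_def add.commute)
qed

end
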